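(* Let $C,D_1,\dots,D_m$ be nonempty closed (possibly nonconvex) subsets of $\mathbb{R}^n$, let $\psi\in\Theta$ and let $\Psi(x) := \sum_{i=1}^{m}\psi(d_{D_i}^2(x))$. Let $x\in C$ and $\xi_i\in P_{D_i}(x)$ for all $i=1,\dots,m$. Let $\alpha>0$ and let $\tilde u(\alpha)$ be a minimizer of $$\min_{u\in C}\ \langle g,u-x\rangle+\frac{1}{2\alpha}\|u-x\|^2,\qquad\text{where } g := 2\sum_{i=1}^m\psi_+'(d_{D_i}^2(x))(x-\xi_i).$$ Then there exists $\beta>0$ so that $$\Psi(\tilde u(\alpha))-\Psi(x)\le\left(-\frac1\beta+\sum_{i=1}^m\psi_+'(d_{D_i}^2(x))\right)\|\tilde u(\alpha)-x\|^2.$$ Indeed, one can take $\beta=\alpha$ when $C$ is in addition convex, and $\beta=2\alpha$ otherwise.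
   Context: $\Theta$ denotes the set of level-bounded (i.e., $\{s\ge0:\psi(s)\le\gamma\}$ is bounded for every $\gamma\in\mathbb{R}$) continuous concave functions $\psi:\mathbb{R}_+\to\mathbb{R}_+$ such that: (1) $\psi$ is continuously differentiable on $(0,\infty)$ with positive derivative and $\psi(0)=0$; (2) $\lim_{s\downarrow0}\psi'(s)$ exists (as a real number) and is positive, and the right derivative $\psi'_+$ is Lipschitz continuous on $\mathbb{R}_+=[0,\infty)$. For a nonempty closed set $D\subseteq\mathbb{R}^n$, $d_D(x)=\inf_{y\in D}\|x-y\|$ is the Euclidean distance to $D$ and $P_D(x)=\{y\in D:\|x-y\|=d_D(x)\}$ is the (nonempty, possibly multi-element) set of projections of $x$ onto $D$. *)

theory Defs
  imports "HOL-Analysis.Analysis"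
begin

definition right_deriv :: "(real \<Rightarrow> real) \<Rightarrow> real \<Rightarrow> real" where
  "right_deriv f s = vector_derivative f (at_right s)"

text \<open>Functions on the nonnegative half-line are represented by total functions on the reals of
  which only the restriction to \<open>{0..}\<close> matters: every clause looks at nonnegative arguments only.
  The derivative at 0 is the one-sided one, so \<open>right_deriv\<close> extends \<open>deriv\<close> from \<open>{0<..}\<close> to
  \<open>{0..}\<close>.\<close>

definition Theta :: "(real \<Rightarrow> real) set" where
  "Theta = {\<psi>.
     \<psi> \<in> {0..} \<rightarrow> {0..} \<and>
     continuous_on {0..} \<psi> \<and>
     concave_on {0..} \<psi> \<and>
     (\<forall>\<gamma>. bounded {s. 0 \<le> s \<and> \<psi> s \<le> \<gamma>}) \<and>
     \<psi> C1_differentiable_on {0<..} \<and>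
     (\<forall>s>0. 0 < deriv \<psi> s) \<and>
     \<psi> 0 = 0 \<and>
     (\<exists>l>0. (deriv \<psi> \<longlongrightarrow> l) (at_right 0)) \<and>
     (\<exists>K. K-lipschitz_on {0..} (right_deriv \<psi>))}"

definition proj_set :: "'a::metric_space set \<Rightarrow> 'a \<Rightarrow> 'a set" where
  "proj_set A x = {y \<in> A. dist x y = infdist x A}"

definition Psi :: "(real \<Rightarrow> real) \<Rightarrow> nat \<Rightarrow> (nat \<Rightarrow> 'a::metric_space set) \<Rightarrow> 'a \<Rightarrow> real" where
  "Psi \<psi> m D x = (\<Sum>i=1..m. \<psi> ((infdist x (D i))\<^sup>2))"

end

theory Submission
  imports Defs
begin

text \<open>A concave \<open>\<psi>\<close> lies below its tangents, so \<open>\<psi>(d\<^sup>2(u)) - \<psi>(d\<^sup>2(x))\<close> is at most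
  \<open>\<psi>'\<^sub>+(d\<^sup>2(x))\<close> times \<open>d\<^sup>2(u) - d\<^sup>2(x) \<le> \<parallel>u - \<xi>\<parallel>\<^sup>2 - \<parallel>x - \<xi>\<parallel>\<^sup>2\<close>. Expanding the square and summing
  gives \<open>\<Psi>(u) - \<Psi>(x) \<le> \<langle>g, u - x\<rangle> + (\<Sum> \<psi>'\<^sub>+) \<parallel>u - x\<parallel>\<^sup>2\<close>. The inner product is at most
  \<open>-\<parallel>u - x\<parallel>\<^sup>2 / (2\<alpha>)\<close> by comparing \<open>u\<close> with the feasible point \<open>x\<close>; if \<open>C\<close> is convex, comparing with
  points of the segment from \<open>u\<close> to \<open>x\<close> close to \<open>u\<close> improves this to \<open>-\<parallel>u - x\<parallel>\<^sup>2 / \<alpha>\<close>.\<close>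

text \<open>\<open>right_deriv\<close> is defined by choice; since the filter
  \<open>at_right s\<close> is nontrivial, any one-sided derivative that exists is the chosen
  value.\<close>

lemma right_deriv_eq:
  assumes "(f has_real_derivative d) (at_right s)"
  shows "right_deriv f s = d"
  using assms unfolding right_deriv_def
  by (intro vector_derivative_within)
     (simp_all add: has_real_derivative_iff_has_vector_derivative trivial_limit_at_right_real)

lemma Theta_has_deriv:
  assumes "\<psi> \<in> Theta" "s > 0"
  shows "(\<psi> has_real_derivative deriv \<psi> s) (at s)"
proof -
  have "\<psi> differentiable (at s)"
    using assms by (auto simp: Theta_def C1_differentiable_on_eq)
  then show ?thesis
    by (simp add: DERIV_deriv_iff_real_differentiable)
qed

text \<open>For s > 0 the point s is interior to \<open>{0..}\<close>, so the tangent inequality for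
  the convex function \<open>- \<psi>\<close> applies; t may still be the endpoint 0.\<close>

lemma Theta_tangent_pos:
  assumes "\<psi> \<in> Theta" "s > 0" "t \<ge> 0"
  shows "\<psi> t \<le> \<psi> s + deriv \<psi> s * (t - s)"
proof -
  have "convex_on {0..} (\<lambda>x. - \<psi> x)"
    using assms(1) by (simp add: Theta_def concave_on_def)
  moreover have "((\<lambda>x. - \<psi> x) has_real_derivative - deriv \<psi> s) (at s within {0..})"
    using Theta_has_deriv[OF assms(1,2)]
    by (intro DERIV_minus) (rule has_field_derivative_at_within)
  ultimately have "- deriv \<psi> s * (t - s) \<le> - \<psi> t - - \<psi> s"
    using assms by (intro convex_on_imp_above_tangent[where A = "{0..}"]) auto
  then show ?thesis by simp
qed

text \<open>At \<open>0\<close> the difference quotient \<open>\<psi> t / t\<close> is squeezed between \<open>\<psi>' t\<close> and the limit of \<open>\<psi>'\<close>.\<close>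
lemma Theta_right_deriv_0:
  assumes "\<psi> \<in> Theta"
  shows "right_deriv \<psi> 0 > 0" "t \<ge> 0 \<Longrightarrow> \<psi> t \<le> right_deriv \<psi> 0 * t"
proof -
  have [simp]: "\<psi> 0 = 0" and cont: "continuous_on {0..} \<psi>"
    using assms by (auto simp: Theta_def)
  obtain l where l: "l > 0" "(deriv \<psi> \<longlongrightarrow> l) (at_right 0)"
    using assms by (auto simp: Theta_def)
  have "(\<psi> \<longlongrightarrow> \<psi> 0) (at 0 within {0..})"
    using cont unfolding continuous_on_def by (rule bspec) simp
  then have lim0: "(\<psi> \<longlongrightarrow> 0) (at_right 0)"
    by (simp add: at_within_Ici_at_right)
  \<comment> \<open>As s decreases to 0, the tangents at s converge to the line of slope l through
    the origin.\<close>
  have upper: "\<psi> t \<le> l * t" if "t \<ge> 0" for t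
  proof (rule tendsto_lowerbound[where F = "at_right 0"])
    show "((\<lambda>s. \<psi> s + deriv \<psi> s * (t - s)) \<longlongrightarrow> l * t) (at_right 0)"
      by (rule tendsto_eq_intros lim0 l(2) refl | simp)+
    show "\<forall>\<^sub>F s in at_right 0. \<psi> t \<le> \<psi> s + deriv \<psi> s * (t - s)"
      using eventually_at_right_less[of 0]
      by eventually_elim (rule Theta_tangent_pos[OF assms _ that])
  qed simp
  have "((\<lambda>t. \<psi> t / t) \<longlongrightarrow> l) (at_right 0)"
  proof (rule tendsto_sandwich[OF _ _ l(2) tendsto_const])
    show "\<forall>\<^sub>F t in at_right 0. deriv \<psi> t \<le> \<psi> t / t"
      using eventually_at_right_less[of 0]
    proof eventually_elim
      case (elim t)
      \<comment> \<open>The tangent at t, evaluated at 0 where \<open>\<psi>\<close> vanishes, lies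
        above 0.\<close>
      then show ?case
        using Theta_tangent_pos[OF assms, of t 0] by (simp add: field_simps)
    qed
    show "\<forall>\<^sub>F t in at_right 0. \<psi> t / t \<le> l"
      using eventually_at_right_less[of 0]
      by eventually_elim (use upper in \<open>simp add: field_simps\<close>)
  qed
  then have "right_deriv \<psi> 0 = l"
    by (intro right_deriv_eq) (simp add: has_field_derivative_iff)
  then show "right_deriv \<psi> 0 > 0" "t \<ge> 0 \<Longrightarrow> \<psi> t \<le> right_deriv \<psi> 0 * t"
    using l(1) upper by auto
qed

lemma Theta_right_deriv_eq_deriv:
  assumes "\<psi> \<in> Theta" "s > 0"
  shows "right_deriv \<psi> s = deriv \<psi> s"
  using Theta_has_deriv[OF assms] by (intro right_deriv_eq) (rule has_field_derivative_at_within)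

lemma Theta_right_deriv_pos:
  assumes "\<psi> \<in> Theta" "s \<ge> 0"
  shows "right_deriv \<psi> s > 0"
proof (cases "s = 0")
  case False
  with assms show ?thesis
    by (simp add: Theta_right_deriv_eq_deriv) (simp add: Theta_def)
qed (use Theta_right_deriv_0[OF assms(1)] in simp)

lemma Theta_tangent:
  assumes "\<psi> \<in> Theta" "s \<ge> 0" "t \<ge> 0"
  shows "\<psi> t \<le> \<psi> s + right_deriv \<psi> s * (t - s)"
proof (cases "s = 0")
  case True
  moreover have "\<psi> 0 = 0" using assms(1) by (simp add: Theta_def)
  ultimately show ?thesis using Theta_right_deriv_0[OF assms(1)] assms(3) by simp
next
  case False
  with assms show ?thesis
    using Theta_tangent_pos[of \<psi> s t] by (simp add: Theta_right_deriv_eq_deriv)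
qed

text \<open>The point \<open>\<xi>\<close> attains the distance from x to A and bounds the distance
  from u to A from above; then expand with u - \<xi> = (u - x) + (x - \<xi>).\<close>

lemma infdist_square_diff_le:
  fixes x u \<xi> :: "'a::real_inner"
  assumes "\<xi> \<in> proj_set A x"
  shows "(infdist u A)\<^sup>2 - (infdist x A)\<^sup>2 \<le> 2 * ((x - \<xi>) \<bullet> (u - x)) + (norm (u - x))\<^sup>2"
proof -
  have "infdist u A \<le> norm (u - \<xi>)" "infdist x A = norm (x - \<xi>)"
    using assms infdist_le[of \<xi> A u] by (auto simp: proj_set_def dist_norm)
  then have "(infdist u A)\<^sup>2 - (infdist x A)\<^sup>2 \<le> (norm (u - \<xi>))\<^sup>2 - (norm (x - \<xi>))\<^sup>2"
    by (simp add: power_mono infdist_nonneg)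
  also have "\<dots> = 2 * ((x - \<xi>) \<bullet> (u - x)) + (norm (u - x))\<^sup>2"
    by (simp add: power2_norm_eq_inner algebra_simps inner_commute)
  finally show ?thesis .
qed

lemma Psi_diff_le:
  fixes x u :: "'a::real_inner"
  assumes "\<psi> \<in> Theta" and "\<And>i. i \<in> {1..m} \<Longrightarrow> \<xi> i \<in> proj_set (D i) x"
  shows "Psi \<psi> m D u - Psi \<psi> m D x \<le>
    (2 *\<^sub>R (\<Sum>i=1..m. right_deriv \<psi> ((infdist x (D i))\<^sup>2) *\<^sub>R (x - \<xi> i))) \<bullet> (u - x)
    + (\<Sum>i=1..m. right_deriv \<psi> ((infdist x (D i))\<^sup>2)) * (norm (u - x))\<^sup>2"
proof -
  define w where "w i = right_deriv \<psi> ((infdist x (D i))\<^sup>2)" for i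
  have "\<psi> ((infdist u (D i))\<^sup>2) - \<psi> ((infdist x (D i))\<^sup>2)
      \<le> w i * (2 * ((x - \<xi> i) \<bullet> (u - x)) + (norm (u - x))\<^sup>2)" if "i \<in> {1..m}" for i
  proof -
    have "\<psi> ((infdist u (D i))\<^sup>2) - \<psi> ((infdist x (D i))\<^sup>2)
        \<le> w i * ((infdist u (D i))\<^sup>2 - (infdist x (D i))\<^sup>2)"
      using Theta_tangent[OF assms(1), of "(infdist x (D i))\<^sup>2" "(infdist u (D i))\<^sup>2"]
      by (simp add: w_def)
    \<comment> \<open>The weight \<open>w i\<close> is positive, so it preserves the estimate of the
      squared distances.\<close>
    also have "\<dots> \<le> w i * (2 * ((x - \<xi> i) \<bullet> (u - x)) + (norm (u - x))\<^sup>2)"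
      using Theta_right_deriv_pos[OF assms(1), of "(infdist x (D i))\<^sup>2"]
      by (intro mult_left_mono infdist_square_diff_le assms(2) that) (simp add: w_def)
    finally show ?thesis .
  qed
  then have "Psi \<psi> m D u - Psi \<psi> m D x
      \<le> (\<Sum>i=1..m. w i * (2 * ((x - \<xi> i) \<bullet> (u - x)) + (norm (u - x))\<^sup>2))"
    unfolding Psi_def sum_subtractf[symmetric] by (rule sum_mono)
  also have "\<dots> = (2 *\<^sub>R (\<Sum>i=1..m. w i *\<^sub>R (x - \<xi> i))) \<bullet> (u - x)
      + (\<Sum>i=1..m. w i) * (norm (u - x))\<^sup>2"
    by (simp add: inner_sum_left sum_distrib_left sum_distrib_right distrib_left sum.distrib
        mult.left_commute)
  finally show ?thesis unfolding w_def .
qed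

text \<open>The objective vanishes at v = x, so its minimal value is at most 0.\<close>

lemma arg_min_quadratic_inner_le:
  fixes x u g :: "'a::real_inner"
  assumes "is_arg_min (\<lambda>v. g \<bullet> (v - x) + 1 / (2 * \<alpha>) * (norm (v - x))\<^sup>2) (\<lambda>v. v \<in> C) u"
    and "x \<in> C"
  shows "g \<bullet> (u - x) \<le> - (1 / (2 * \<alpha>)) * (norm (u - x))\<^sup>2"
  using assms by (force simp: is_arg_min_linorder)

lemma arg_min_quadratic_inner_le_convex:
  fixes x u g :: "'a::real_inner"
  assumes min: "is_arg_min (\<lambda>v. g \<bullet> (v - x) + 1 / (2 * \<alpha>) * (norm (v - x))\<^sup>2) (\<lambda>v. v \<in> C) u"
    and "x \<in> C" "convex C"
  shows "g \<bullet> (u - x) \<le> - (1 / \<alpha>) * (norm (u - x))\<^sup>2"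
proof -
  define a N where "a = g \<bullet> (u - x)" and "N = 1 / (2 * \<alpha>) * (norm (u - x))\<^sup>2"
  \<comment> \<open>Moving u towards x by the fraction t scales the linear term by 1 - t and the
    quadratic term by its square; minimality of u allows division by t.\<close>
  have step: "a \<le> (t - 2) * N" if t: "0 < t" "t < 1" for t
  proof -
    have "u \<in> C" using min by (simp add: is_arg_min_linorder)
    then have "(1 - t) *\<^sub>R u + t *\<^sub>R x \<in> C"
      using assms(2,3) t by (intro convexD) auto
    moreover have "(1 - t) *\<^sub>R u + t *\<^sub>R x - x = (1 - t) *\<^sub>R (u - x)"
      by (simp add: algebra_simps)
    ultimately have "a + N \<le> (1 - t) * a + (1 - t)\<^sup>2 * N"
      using min unfolding is_arg_min_linorder a_def N_def
      by (fastforce simp: power_mult_distrib mult.left_commute)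
    then have "t * a \<le> t * ((t - 2) * N)"
      by (simp add: power2_eq_square algebra_simps)
    then show ?thesis using t(1) by simp
  qed
  \<comment> \<open>Letting t tend to 0 gives the factor -2, whereas comparison with x itself (t =
    1) gives only -1.\<close>
  have "a \<le> (0 - 2) * N"
  proof (rule tendsto_lowerbound[where F = "at_right 0"])
    show "((\<lambda>t. (t - 2) * N) \<longlongrightarrow> (0 - 2) * N) (at_right 0)"
      by (intro tendsto_intros)
    show "\<forall>\<^sub>F t in at_right 0. a \<le> (t - 2) * N"
      using eventually_at_right_real[of 0 1] by (auto elim!: eventually_mono intro: step)
  qed simp
  then show ?thesis by (simp add: a_def N_def)
qed

theorem proposition4p1:
  fixes C :: "(real ^ 'n) set"
    and D :: "nat \<Rightarrow> (real ^ 'n) set"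
    and m :: nat
    and \<psi> :: "real \<Rightarrow> real"
    and x g u :: "real ^ 'n"
    and \<xi> :: "nat \<Rightarrow> real ^ 'n"
    and \<alpha> :: real
  assumes "m \<ge> 1"
    and "closed C" and "C \<noteq> {}"
    and "\<And>i. i \<in> {1..m} \<Longrightarrow> closed (D i)"
    and "\<And>i. i \<in> {1..m} \<Longrightarrow> D i \<noteq> {}"
    and "\<psi> \<in> Theta"
    and "x \<in> C"
    and "\<And>i. i \<in> {1..m} \<Longrightarrow> \<xi> i \<in> proj_set (D i) x"
    and "g = 2 *\<^sub>R (\<Sum>i=1..m. right_deriv \<psi> ((infdist x (D i))\<^sup>2) *\<^sub>R (x - \<xi> i))"
    and "\<alpha> > 0"
    and "is_arg_min (\<lambda>v. g \<bullet> (v - x) + 1 / (2 * \<alpha>) * (norm (v - x))\<^sup>2) (\<lambda>v. v \<in> C) u"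
  shows "let estimate = (\<lambda>\<beta>::real. Psi \<psi> m D u - Psi \<psi> m D x
               \<le> (- (1 / \<beta>) + (\<Sum>i=1..m. right_deriv \<psi> ((infdist x (D i))\<^sup>2)))
                  * (norm (u - x))\<^sup>2)
         in (\<exists>\<beta>>0. estimate \<beta>)
            \<and> (convex C \<longrightarrow> estimate \<alpha>)
            \<and> (\<not> convex C \<longrightarrow> estimate (2 * \<alpha>))"
proof -
  define W where "W = (\<Sum>i=1..m. right_deriv \<psi> ((infdist x (D i))\<^sup>2))"
  \<comment> \<open>The choice of \<beta> is thus reduced to a bound on the inner product with
    g.\<close>
  have bound: "Psi \<psi> m D u - Psi \<psi> m D x \<le> (- (1 / \<beta>) + W) * (norm (u - x))\<^sup>2"
    if "g \<bullet> (u - x) \<le> - (1 / \<beta>) * (norm (u - x))\<^sup>2" for \<beta>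
    using Psi_diff_le[where u = u and m = m and D = D and \<xi> = \<xi>, OF assms(6,8)] that
    unfolding assms(9)[symmetric] W_def[symmetric] distrib_right by linarith
  have "Psi \<psi> m D u - Psi \<psi> m D x \<le> (- (1 / (2 * \<alpha>)) + W) * (norm (u - x))\<^sup>2"
    by (rule bound, rule arg_min_quadratic_inner_le[OF assms(11,7)])
  moreover have "Psi \<psi> m D u - Psi \<psi> m D x \<le> (- (1 / \<alpha>) + W) * (norm (u - x))\<^sup>2"
    if "convex C"
    by (rule bound, rule arg_min_quadratic_inner_le_convex[OF assms(11,7) that])
  \<comment> \<open>The estimate for 2\<alpha> holds whether or not C is convex, so 2\<alpha> can
    serve as the witness for \<beta>.\<close>
  moreover have "2 * \<alpha> > 0" using assms(10) by simp
  ultimately show ?thesis unfolding Let_def W_def by blast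
qed

end
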